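(* Let $n\ge 3$ and let $A=(a_{ij})\in\mathbb{C}^{n\times n}$ be irreducible with $A\in H^M_n$. Then $\rho(H_{BGS})<1$ (i.e., the sequence $\{x^{(i)}\}$ generated by the BGS scheme converges to the unique solution of $Ax=b$ for any choice of the initial guess $x^{(0)}$) if and only if $D_A^{-1}A\notin \mathscr{L}^{\phi}_n$ for every $\phi\in\mathbb{R}$.
   Context: The comparison matrix $\mu(A)=(\mu_{ij})$ of $A\in\mathbb{C}^{n\times n}$ has $\mu_{ii}=|a_{ii}|$ and $\mu_{ij}=-|a_{ij}|$ for $i\ne j$. A real matrix with nonpositive off-diagonal entries is an $M$-matrix if it equals $sI-B$ with $B\ge 0$ entrywise and $s\ge\rho(B)$; it is a singular $M$-matrix if $s=\rho(B)$. $H^M_n$ (mixed $H$-matrices) is the set of $A\in\mathbb{C}^{n\times n}$ such that $\mu(A)$ is a singular $M$-matrix and $a_{ii}\ne 0$ for all $i$. Write $A=D_A-L_A-U_A$ with $D_A=\mathrm{diag}(a_{11},\dots,a_{nn})$, $L_A$ strictly lower triangular, $U_A$ strictly upper triangular. The backward Gauss-Seidel (BGS) iteration matrix is $H_{BGS}=(D_A-U_A)^{-1}L_A$, and the BGS scheme for $Ax=b$ is $x^{(i+1)}=H_{BGS}x^{(i)}+(D_A-U_A)^{-1}b$, $i=0,1,2,\dots$. $\rho$ denotes the spectral radius. A matrix $(e^{i\phi_{rs}})\in\mathbb{C}^{n\times n}$ ($\phi_{rs}\in\mathbb{R}$, $i=\sqrt{-1}$) is a $\phi$-ray pattern matrix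 ($\phi\in\mathbb{R}$) if, modulo $2\pi$: (1) $\phi_{rs}+\phi_{sr}\equiv\phi$ for all $r\ne s$; (2) $\phi_{rs}-\phi_{rt}\equiv\phi_{ts}-\phi+\pi$ whenever $r<s<t$ or $s<t<r$ or $t<r<s$; (3) $\phi_{rs}-\phi_{rt}\equiv\phi_{ts}+\pi$ whenever $r<t<s$ or $t<s<r$ or $s<r<t$; (4) $\phi_{rr}=0$ for all $r$. $\mathscr{L}^{\phi}_n$ is the set of $n\times n$ complex matrices $B=(b_{rs})$ for which there exist $\eta\in\mathbb{R}$ and a $\phi$-ray pattern matrix $(e^{i\phi_{rs}})$ with $b_{rs}=e^{i\eta}|b_{rs}|e^{i\phi_{rs}}$ for all $r,s$. *)

theory Defs
  imports
    "Jordan_Normal_Form.Spectral_Radius"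
    "Jordan_Normal_Form.Gauss_Jordan_Elimination"
    "HOL-Library.Real_Mod"
    "HOL-Combinatorics.Permutations"
begin

text \<open>
  An \<open>n \<times> n\<close> matrix is an element of \<open>carrier_mat n n\<close>, so rows and columns are numbered
  \<open>0, \<dots>, n - 1\<close>; only the order of the indices matters below.
\<close>

text \<open>
  Total version of the library's matrix inverse, unspecified on matrices without an inverse. It is
  applied to triangular matrices with nonzero diagonal only.
\<close>

definition mat_inv :: "'a :: field mat \<Rightarrow> 'a mat" where
  "mat_inv A = the (mat_inverse A)"

text \<open>
  \<open>P A P\<^sup>T\<close> is block upper triangular with square diagonal blocks of orders \<open>k\<close> and \<open>n - k\<close>, where
  the permutation matrix \<open>P\<close> is given by the permutation \<open>p\<close>, that is,
  \<open>(P A P\<^sup>T)\<^sub>i\<^sub>j = A $$ (p i, p j)\<close>.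
\<close>

definition reducible_mat :: "'a :: zero mat \<Rightarrow> bool" where
  "reducible_mat A \<longleftrightarrow> (\<exists>p k. p permutes {..<dim_row A} \<and> 0 < k \<and> k < dim_row A \<and>
     (\<forall>i\<in>{k..<dim_row A}. \<forall>j<k. A $$ (p i, p j) = 0))"

definition irreducible_mat :: "'a :: zero mat \<Rightarrow> bool" where
  "irreducible_mat A \<longleftrightarrow> \<not> reducible_mat A"

definition comparison_mat :: "complex mat \<Rightarrow> real mat" where
  "comparison_mat A = mat (dim_row A) (dim_col A)
     (\<lambda>(i, j). if i = j then cmod (A $$ (i, j)) else - cmod (A $$ (i, j)))"

text \<open>The condition \<open>s = \<rho>(B)\<close> replaces \<open>s \<ge> \<rho>(B)\<close> in the definition of an M-matrix.\<close>

definition singular_M_matrix :: "nat \<Rightarrow> real mat \<Rightarrow> bool" where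
  "singular_M_matrix n M \<longleftrightarrow> M \<in> carrier_mat n n \<and>
     (\<forall>i<n. \<forall>j<n. i \<noteq> j \<longrightarrow> M $$ (i, j) \<le> 0) \<and>
     (\<exists>s. \<exists>B\<in>carrier_mat n n. 0\<^sub>m n n \<le> B \<and> M = s \<cdot>\<^sub>m 1\<^sub>m n - B \<and>
        s = spectral_radius (map_mat complex_of_real B))"

definition mixed_H_matrices :: "nat \<Rightarrow> complex mat set" where
  "mixed_H_matrices n = {A \<in> carrier_mat n n.
     singular_M_matrix n (comparison_mat A) \<and> (\<forall>i<n. A $$ (i, i) \<noteq> 0)}"

text \<open>The signs in the two triangular parts are those of the splitting \<open>A = D - L - U\<close>.\<close>

definition diag_part :: "'a :: zero mat \<Rightarrow> 'a mat" where
  "diag_part A = mat_diag (dim_row A) (\<lambda>i. A $$ (i, i))"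

definition lower_part :: "'a :: ring mat \<Rightarrow> 'a mat" where
  "lower_part A = mat (dim_row A) (dim_col A) (\<lambda>(i, j). if j < i then - (A $$ (i, j)) else 0)"

definition upper_part :: "'a :: ring mat \<Rightarrow> 'a mat" where
  "upper_part A = mat (dim_row A) (dim_col A) (\<lambda>(i, j). if i < j then - (A $$ (i, j)) else 0)"

lemma splitting:
  fixes A :: "'a :: ring mat"
  assumes "A \<in> carrier_mat n n"
  shows "A = diag_part A - lower_part A - upper_part A"
  using assms
  by (intro eq_matI) (auto simp: diag_part_def lower_part_def upper_part_def mat_diag_def)

definition BGS_mat :: "'a :: field mat \<Rightarrow> 'a mat" where
  "BGS_mat A = mat_inv (diag_part A - upper_part A) * lower_part A"

primrec BGS_seq :: "'a :: field mat \<Rightarrow> 'a vec \<Rightarrow> 'a vec \<Rightarrow> nat \<Rightarrow> 'a vec" where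
  "BGS_seq A b x0 0 = x0"
| "BGS_seq A b x0 (Suc i) =
     BGS_mat A *\<^sub>v BGS_seq A b x0 i + mat_inv (diag_part A - upper_part A) *\<^sub>v b"

text \<open>
  The type \<open>vec\<close> carries no topology; convergence in \<open>\<complex>\<^sup>n\<close> is componentwise convergence.
\<close>

definition vec_tendsto :: "nat \<Rightarrow> (nat \<Rightarrow> complex vec) \<Rightarrow> complex vec \<Rightarrow> bool" where
  "vec_tendsto n xs x \<longleftrightarrow> (\<forall>j<n. (\<lambda>i. xs i $ j) \<longlonglongrightarrow> x $ j)"

text \<open>
  \<open>A x = b\<close> has exactly one solution and the BGS iterates converge to it from every initial guess.
\<close>

definition BGS_converges :: "nat \<Rightarrow> complex mat \<Rightarrow> complex vec \<Rightarrow> bool" where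
  "BGS_converges n A b \<longleftrightarrow> (\<exists>x. {y \<in> carrier_vec n. A *\<^sub>v y = b} = {x} \<and>
     (\<forall>x0\<in>carrier_vec n. vec_tendsto n (BGS_seq A b x0) x))"

definition ray_pattern_mat :: "real \<Rightarrow> nat \<Rightarrow> complex mat \<Rightarrow> bool" where
  "ray_pattern_mat \<phi> n P \<longleftrightarrow> (\<exists>f :: nat \<Rightarrow> nat \<Rightarrow> real.
     P = mat n n (\<lambda>(r, s). exp (\<i> * complex_of_real (f r s))) \<and>
     (\<forall>r<n. \<forall>s<n. r \<noteq> s \<longrightarrow> [f r s + f s r = \<phi>] (rmod (2 * pi))) \<and>
     (\<forall>r<n. \<forall>s<n. \<forall>t<n. (r < s \<and> s < t) \<or> (s < t \<and> t < r) \<or> (t < r \<and> r < s) \<longrightarrow>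
        [f r s - f r t = f t s - \<phi> + pi] (rmod (2 * pi))) \<and>
     (\<forall>r<n. \<forall>s<n. \<forall>t<n. (r < t \<and> t < s) \<or> (t < s \<and> s < r) \<or> (s < r \<and> r < t) \<longrightarrow>
        [f r s - f r t = f t s + pi] (rmod (2 * pi))) \<and>
     (\<forall>r<n. [f r r = 0] (rmod (2 * pi))))"

text \<open>The set \<open>\<L>\<^sup>\<phi>\<^sub>n\<close>.\<close>

definition ray_class :: "real \<Rightarrow> nat \<Rightarrow> complex mat set" where
  "ray_class \<phi> n = {B \<in> carrier_mat n n. \<exists>\<eta> :: real. \<exists>P. ray_pattern_mat \<phi> n P \<and>
     (\<forall>r<n. \<forall>s<n. B $$ (r, s) =
        exp (\<i> * complex_of_real \<eta>) * complex_of_real (cmod (B $$ (r, s))) * P $$ (r, s))}"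

end

theory Submission
  imports Defs
begin

text \<open>
  Perron-Frobenius theory gives a positive vector \<open>v\<close> with \<open>\<mu>(A) v = 0\<close>, so after scaling by \<open>v\<close> the
  moduli of the off-diagonal entries of \<open>D\<^sup>-\<^sup>1 A\<close> sum to 1 in each row. If \<open>\<lambda>\<close> is an eigenvalue of the
  iteration matrix with \<open>\<bar>\<lambda>\<bar> \<ge> 1\<close>, the eigenvector equation writes each component as a combination of
  the others whose coefficients have moduli summing to at most 1. Irreducibility and the equality
  case of the triangle inequality force \<open>\<bar>\<lambda>\<bar> = 1\<close>, components of equal modulus, and arguments of the
  entries of \<open>D\<^sup>-\<^sup>1 A\<close> determined by \<open>\<lambda>\<close> and the eigenvector; these are the ray patterns with
  \<open>\<phi> = arg \<lambda>\<close>. Conversely, such a pattern yields an eigenvector for \<open>\<lambda> = e\<^sup>i\<^sup>\<phi>\<close>.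
\<close>

section \<open>Powers and the spectral radius\<close>

lemma pow_mat_Suc_left:
  fixes A :: "'a :: semiring_1 mat"
  assumes A: "A \<in> carrier_mat n n"
  shows "A ^\<^sub>m Suc k = A * A ^\<^sub>m k"
proof (induction k)
  case (Suc k)
  have "A ^\<^sub>m Suc (Suc k) = (A * A ^\<^sub>m k) * A"
    using Suc by simp
  also have "\<dots> = A * A ^\<^sub>m Suc k"
    using A by (simp add: assoc_mult_mat[of _ n n _ n _ n])
  finally show ?case .
qed (use A in auto)

lemma smult_pow_mat:
  fixes A :: "'a :: comm_semiring_1 mat"
  assumes A: "A \<in> carrier_mat n n"
  shows "(c \<cdot>\<^sub>m A) ^\<^sub>m k = c ^ k \<cdot>\<^sub>m (A ^\<^sub>m k)"
proof (induction k)
  case (Suc k)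
  have "(c \<cdot>\<^sub>m A) ^\<^sub>m Suc k = (c ^ k \<cdot>\<^sub>m (A ^\<^sub>m k)) * (c \<cdot>\<^sub>m A)"
    using Suc by simp
  also have "\<dots> = (c ^ k * c) \<cdot>\<^sub>m (A ^\<^sub>m k * A)"
    using A by (intro eq_matI) (auto simp: scalar_prod_def sum_distrib_left ac_simps)
  finally show ?case
    by (simp add: mult.commute)
qed (use A in \<open>auto intro!: eq_matI\<close>)

text \<open>An eigenvalue \<open>l\<close> of the scaled matrix yields the eigenvalue
  \<open>r * l\<close> of \<open>A\<close>, whose modulus is less than \<open>r\<close>.\<close>

lemma spectral_radius_smult_less_1:
  fixes A :: "complex mat"
  assumes A: "A \<in> carrier_mat n n" and n: "n > 0"
    and r: "0 < r" "spectral_radius A < r"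
  shows "spectral_radius (complex_of_real (1 / r) \<cdot>\<^sub>m A) < 1"
proof -
  let ?C = "complex_of_real (1 / r) \<cdot>\<^sub>m A"
  have C: "?C \<in> carrier_mat n n"
    using A by simp
  obtain l where l: "l \<in> spectrum ?C" "spectral_radius ?C = cmod l"
    using spectral_radius_mem_max(1)[OF C n] by auto
  then obtain v where v: "v \<in> carrier_vec n" "v \<noteq> 0\<^sub>v n" "?C *\<^sub>v v = l \<cdot>\<^sub>v v"
    using C A by (auto simp: spectrum_def eigenvalue_def eigenvector_def)
  have "A *\<^sub>v v = complex_of_real r * l \<cdot>\<^sub>v v"
  proof (intro eq_vecI)
    fix i assume i: "i < dim_vec (complex_of_real r * l \<cdot>\<^sub>v v)"
    have "(?C *\<^sub>v v) $ i = l * v $ i"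
      unfolding v(3) using v(1) i by simp
    moreover have "(?C *\<^sub>v v) $ i = complex_of_real (1 / r) * (A *\<^sub>v v) $ i"
      using A v(1) i by (auto simp: scalar_prod_def sum_distrib_left mult.assoc)
    ultimately show "(A *\<^sub>v v) $ i = (complex_of_real r * l \<cdot>\<^sub>v v) $ i"
      using r v(1) i by (simp add: field_simps)
  qed (use A v in auto)
  then have "complex_of_real r * l \<in> spectrum A"
    using A v by (auto simp: spectrum_def eigenvalue_def eigenvector_def)
  then have "r * cmod l \<le> spectral_radius A"
    using spectral_radius_mem_max(2)[OF A n imageI, of "complex_of_real r * l"] r
    by (simp add: norm_mult)
  then have "r * cmod l < r * 1"
    using r by linarith
  then show ?thesis
    using l r by (simp only: mult_less_cancel_left_pos)
qed

text \<open>Scaled by \<open>1 / r\<close>, the matrix has spectral radius below 1, so its powers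
  are bounded entrywise. Undoing the scaling turns the constant bound into the rate
  \<open>r ^ k\<close>.\<close>

lemma pow_mat_vec_bound:
  fixes A :: "complex mat"
  assumes A: "A \<in> carrier_mat n n" and n: "n > 0"
    and r: "0 < r" "spectral_radius A < r" and v: "v \<in> carrier_vec n"
  obtains c where "\<And>k i. i < n \<Longrightarrow> cmod ((A ^\<^sub>m k *\<^sub>v v) $ i) \<le> c * r ^ k"
proof -
  let ?C = "complex_of_real (1 / r) \<cdot>\<^sub>m A"
  have C: "?C \<in> carrier_mat n n"
    using A by simp
  obtain d where d: "norm_bound (?C ^\<^sub>m k) d" for k
    using spectral_radius_jnf_norm_bound_less_1_upper_triangular
      [OF C spectral_radius_smult_less_1[OF A n r]] by auto
  have entry: "cmod ((A ^\<^sub>m k) $$ (i, j)) \<le> d * r ^ k" if "i < n" "j < n" for i j k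
  proof -
    have "cmod ((?C ^\<^sub>m k) $$ (i, j)) \<le> d"
      using d[of k] that C A unfolding norm_bound_def by simp
    then have "cmod ((A ^\<^sub>m k) $$ (i, j)) / r ^ k \<le> d"
      using that A r by (simp add: smult_pow_mat[OF A] norm_mult norm_divide norm_power power_divide)
    then show ?thesis
      using r by (simp add: field_simps)
  qed
  show ?thesis
  proof (rule that)
    fix k i assume i: "i < n"
    have "cmod ((A ^\<^sub>m k *\<^sub>v v) $ i) = cmod (\<Sum>j<n. (A ^\<^sub>m k) $$ (i, j) * v $ j)"
      using A v i by (simp add: scalar_prod_def atLeast0LessThan)
    also have "\<dots> \<le> (\<Sum>j<n. d * r ^ k * cmod (v $ j))"
      by (intro sum_norm_le) (auto simp: norm_mult intro!: mult_right_mono entry i)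
    also have "\<dots> = (d * (\<Sum>j<n. cmod (v $ j))) * r ^ k"
      by (simp add: sum_distrib_left sum_distrib_right mult_ac)
    finally show "cmod ((A ^\<^sub>m k *\<^sub>v v) $ i) \<le> (d * (\<Sum>j<n. cmod (v $ j))) * r ^ k" .
  qed
qed

lemma spectral_radius_nonneg:
  assumes "A \<in> carrier_mat n n" "n > 0"
  shows "0 \<le> spectral_radius A"
  using spectral_radius_mem_max(1)[OF assms] by auto

lemma pow_mat_vec_tendsto_0:
  fixes A :: "complex mat"
  assumes A: "A \<in> carrier_mat n n" and n: "n > 0"
    and sr: "spectral_radius A < 1" and v: "v \<in> carrier_vec n" and i: "i < n"
  shows "(\<lambda>k. (A ^\<^sub>m k *\<^sub>v v) $ i) \<longlonglongrightarrow> 0"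
proof -
  obtain r where r: "spectral_radius A < r" "r < 1"
    using sr dense by blast
  then have r0: "0 < r"
    using spectral_radius_nonneg[OF A n] by simp
  obtain c where c: "\<And>k i. i < n \<Longrightarrow> cmod ((A ^\<^sub>m k *\<^sub>v v) $ i) \<le> c * r ^ k"
    using pow_mat_vec_bound[OF A n r0 r(1) v] by blast
  have "(\<lambda>k. c * r ^ k) \<longlonglongrightarrow> c * 0"
    using r r0 by (intro tendsto_intros LIMSEQ_realpow_zero) auto
  then have "(\<lambda>k. c * r ^ k) \<longlonglongrightarrow> 0"
    by simp
  then show ?thesis
  proof (rule tendsto_0_le[where K = 1, OF _ always_eventually])
    show "\<forall>k. norm ((A ^\<^sub>m k *\<^sub>v v) $ i) \<le> norm (c * r ^ k) * 1"
      using c[OF i] by (metis abs_ge_self mult.right_neutral order_trans real_norm_def)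
  qed
qed

text \<open>The Collatz-Wielandt lower bound. Iterating the hypothesis shows that the powers of
  \<open>B\<close> applied to \<open>y\<close> grow at least like \<open>t ^ k\<close>, whereas they
  grow at most like \<open>r ^ k\<close> for each positive \<open>r\<close> above the spectral
  radius.\<close>

lemma subinvariant_le_spectral_radius:
  fixes B :: "real mat" and y :: "nat \<Rightarrow> real"
  assumes B: "B \<in> carrier_mat n n" and B0: "\<And>i j. i < n \<Longrightarrow> j < n \<Longrightarrow> 0 \<le> B $$ (i, j)"
    and y: "m < n" "0 < y m" "\<And>i. i < n \<Longrightarrow> 0 \<le> y i"
    and t: "0 \<le> t" and sub: "\<And>i. i < n \<Longrightarrow> t * y i \<le> (\<Sum>j<n. B $$ (i, j) * y j)"
  shows "t \<le> spectral_radius (map_mat complex_of_real B)"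
proof (rule ccontr)
  let ?A = "map_mat complex_of_real B"
  let ?v = "vec n (\<lambda>i. complex_of_real (y i))"
  have A: "?A \<in> carrier_mat n n" and n: "n > 0"
    using B y by auto
  assume "\<not> ?thesis"
  then obtain r where r: "spectral_radius ?A < r" "r < t"
    using dense by (metis not_le)
  then have r0: "0 < r"
    using spectral_radius_nonneg[OF A n] by simp
  \<comment> \<open>The powers act on complex vectors, so the induction also has to carry the fact
    that the components stay real; only then can they be compared with
    \<open>t ^ k * y i\<close>.\<close>
  have growth: "\<forall>i<n. \<exists>u. (?A ^\<^sub>m k *\<^sub>v ?v) $ i = complex_of_real u \<and> t ^ k * y i \<le> u" for k
  proof (induction k)
    case 0
    then show ?case
      using B by auto
  next
    case (Suc k)
    then obtain u where u: "\<And>i. i < n \<Longrightarrow> (?A ^\<^sub>m k *\<^sub>v ?v) $ i = complex_of_real (u i)"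
      "\<And>i. i < n \<Longrightarrow> t ^ k * y i \<le> u i"
      by metis
    show ?case
    proof (intro allI impI exI conjI)
      fix i assume i: "i < n"
      have "?A ^\<^sub>m Suc k *\<^sub>v ?v = ?A *\<^sub>v (?A ^\<^sub>m k *\<^sub>v ?v)"
        unfolding pow_mat_Suc_left[OF A]
        by (rule assoc_mult_mat_vec[OF A pow_carrier_mat[OF A]]) auto
      then show "(?A ^\<^sub>m Suc k *\<^sub>v ?v) $ i = complex_of_real (\<Sum>j<n. B $$ (i, j) * u j)"
        using i B u(1) by (simp add: scalar_prod_def atLeast0LessThan del: pow_mat.simps)
      have "t ^ Suc k * y i = t ^ k * (t * y i)"
        by simp
      also have "\<dots> \<le> t ^ k * (\<Sum>j<n. B $$ (i, j) * y j)"
        using t sub[OF i] by (intro mult_left_mono) auto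
      also have "\<dots> = (\<Sum>j<n. B $$ (i, j) * (t ^ k * y j))"
        by (simp add: sum_distrib_left mult_ac)
      also have "\<dots> \<le> (\<Sum>j<n. B $$ (i, j) * u j)"
        using u(2) B0 i by (intro sum_mono mult_left_mono) auto
      finally show "t ^ Suc k * y i \<le> (\<Sum>j<n. B $$ (i, j) * u j)" .
    qed
  qed
  obtain c where c: "\<And>k i. i < n \<Longrightarrow> cmod ((?A ^\<^sub>m k *\<^sub>v ?v) $ i) \<le> c * r ^ k"
    using pow_mat_vec_bound[OF A n r0 r(1), of ?v] by auto
  \<comment> \<open>Both growth estimates are compared at \<open>m\<close>, where \<open>y\<close>
    is positive. They bound all powers of \<open>t / r\<close>, a number greater than 1.\<close>
  have bound: "(t / r) ^ k \<le> c / y m" for k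
  proof -
    obtain u where "(?A ^\<^sub>m k *\<^sub>v ?v) $ m = complex_of_real u" "t ^ k * y m \<le> u"
      using growth[of k] y(1) by blast
    then have "t ^ k * y m \<le> c * r ^ k"
      using c[OF y(1), of k] by simp
    then show ?thesis
      using y(2) r0 by (simp add: field_simps)
  qed
  have "1 < t / r"
    using r r0 by simp
  then obtain k where "c / y m < (t / r) ^ k"
    using real_arch_pow by blast
  with bound[of k] show False
    by simp
qed

section \<open>A Perron vector of an irreducible nonnegative matrix\<close>

text \<open>Strong connectivity of the directed graph of \<open>R\<close>, encoded by edges that
  leave a vertex set instead of by paths. This suits arguments in which \<open>S\<close> is the set
  where an equality or an extreme value is attained and the edge leads out of it.\<close>

definition connected_on :: "nat \<Rightarrow> (nat \<Rightarrow> nat \<Rightarrow> bool) \<Rightarrow> bool" where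
  "connected_on n R \<longleftrightarrow>
     (\<forall>S. S \<subseteq> {..<n} \<longrightarrow> S \<noteq> {} \<longrightarrow> S \<noteq> {..<n} \<longrightarrow> (\<exists>i\<in>S. \<exists>j\<in>{..<n} - S. R i j))"

lemma connected_onE:
  assumes "connected_on n R" "S \<subseteq> {..<n}" "S \<noteq> {}" "S \<noteq> {..<n}"
  obtains i j where "i \<in> S" "j < n" "j \<notin> S" "R i j"
  using assms unfolding connected_on_def by (metis DiffE lessThan_iff)

text \<open>If no nonzero entry leads out of \<open>S\<close>, then listing the complement of
  \<open>S\<close> first and \<open>S\<close> last makes the matrix block upper triangular.\<close>

lemma irreducible_mat_connected_on:
  assumes A: "A \<in> carrier_mat n n" and irr: "irreducible_mat A"
  shows "connected_on n (\<lambda>i j. A $$ (i, j) \<noteq> 0)"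
  unfolding connected_on_def
proof (intro allI impI, rule ccontr)
  fix S assume S: "S \<subseteq> {..<n}" "S \<noteq> {}" "S \<noteq> {..<n}"
    and no: "\<not> (\<exists>i\<in>S. \<exists>j\<in>{..<n} - S. A $$ (i, j) \<noteq> 0)"
  let ?T = "{..<n} - S"
  define k where "k = card ?T"
  have fin: "finite S"
    using S finite_subset by blast
  have card: "card S + k = n"
    unfolding k_def using card_Diff_subset[OF fin S(1)] card_mono[OF _ S(1)] by simp
  have k0: "0 < k"
    unfolding k_def using S by (auto simp: card_gt_0_iff)
  have kn: "k < n"
    using card S(2) fin card_gt_0_iff[of S] by simp
  obtain f where f: "bij_betw f {..<k} ?T"
    using finite_same_card_bij[of "{..<k}" ?T] by (auto simp: k_def)
  obtain g where g: "bij_betw g {k..<n} S"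
    using finite_same_card_bij[of "{k..<n}" S] fin card by auto
  \<comment> \<open>The first \<open>k\<close> positions enumerate the complement of
    \<open>S\<close>, the next ones \<open>S\<close>; beyond \<open>n\<close> the identity is needed
    for \<open>permutes\<close>.\<close>
  define p where "p i = (if i < k then f i else if i < n then g i else i)" for i
  have pf: "bij_betw p {..<k} ?T"
    using f by (subst bij_betw_cong[of _ _ f]) (auto simp: p_def)
  have pg: "bij_betw p {k..<n} S"
    using g by (subst bij_betw_cong[of _ _ g]) (auto simp: p_def)
  have "bij_betw p ({..<k} \<union> {k..<n}) (?T \<union> S)"
    by (intro bij_betw_combine pf pg) auto
  moreover have "{..<k} \<union> {k..<n} = {..<n}" "?T \<union> S = {..<n}"
    using kn S by auto
  ultimately have "bij_betw p {..<n} {..<n}"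
    by simp
  then have "p permutes {..<n}"
    by (rule bij_imp_permutes) (use kn in \<open>auto simp: p_def\<close>)
  moreover have "A $$ (p i, p j) = 0" if "i \<in> {k..<n}" "j < k" for i j
    using no bij_betwE[OF pg] bij_betwE[OF pf] that by blast
  ultimately have "reducible_mat A"
    unfolding reducible_mat_def using A k0 kn by (intro exI[of _ p] exI[of _ k]) auto
  then show False
    using irr by (simp add: irreducible_mat_def)
qed

text \<open>Raising \<open>y\<close> a little at an index with strict inequality keeps that inequality strict and makes
  an equality adjacent to it strict. Iterating, all inequalities become strict, so that \<open>s\<close>
  could be replaced by a larger number, beyond the spectral radius.\<close>

lemma subinvariant_eq:
  fixes B :: "real mat" and y :: "nat \<Rightarrow> real"
  assumes B: "B \<in> carrier_mat n n" and B0: "\<And>i j. i < n \<Longrightarrow> j < n \<Longrightarrow> 0 \<le> B $$ (i, j)"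
    and conn: "connected_on n (\<lambda>i j. B $$ (i, j) \<noteq> 0)"
    and s: "s = spectral_radius (map_mat complex_of_real B)"
    and y: "m < n" "0 < y m" "\<And>i. i < n \<Longrightarrow> 0 \<le> y i"
    and sub: "\<And>i. i < n \<Longrightarrow> s * y i \<le> (\<Sum>j<n. B $$ (i, j) * y j)"
    and i: "i < n"
  shows "(\<Sum>j<n. B $$ (i, j) * y j) = s * y i"
proof -
  define E where "E y = {i. i < n \<and> (\<Sum>j<n. B $$ (i, j) * y j) = s * y i}" for y :: "nat \<Rightarrow> real"
  have s0: "0 \<le> s"
    unfolding s using B y(1) by (intro spectral_radius_nonneg[of _ n]) auto
  have finE: "finite (E y)" for y
    unfolding E_def by simp
  have "E y = {..<n}"
    using y sub
  proof (induction "card (E y)" arbitrary: y rule: less_induct)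
    case (less y)
    note y = less.prems(1-3) and sub = less.prems(4)
    show ?case
    proof (rule ccontr)
      assume ne: "E y \<noteq> {..<n}"
      show False
      proof (cases "E y = {}")
        case True
        \<comment> \<open>All inequalities are strict here. \<open>q i\<close> is an amount by which
          \<open>s\<close> can grow in row \<open>i\<close>; the denominator is
          \<open>y i + 1\<close> because \<open>y i\<close> may be 0. The least of these amounts
          serves all rows at once.\<close>
        define q where "q i = ((\<Sum>j<n. B $$ (i, j) * y j) - s * y i) / (y i + 1)" for i
        have q: "0 < q i" if "i < n" for i
        proof -
          have "s * y i < (\<Sum>j<n. B $$ (i, j) * y j)"
            using sub[OF that] True that unfolding E_def by force
          then show ?thesis
            unfolding q_def using y(3)[OF that] by (intro divide_pos_pos) auto
        qed
        define e where "e = Min (q ` {..<n})"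
        have e0: "0 < e"
          unfolding e_def using q y(1) by (subst Min_gr_iff) auto
        have "s + e \<le> spectral_radius (map_mat complex_of_real B)"
        proof (rule subinvariant_le_spectral_radius[OF B B0 y(1), where y = y])
          fix i assume i: "i < n"
          have "e \<le> q i"
            unfolding e_def using i by (intro Min_le) auto
          then have "e * (y i + 1) \<le> (\<Sum>j<n. B $$ (i, j) * y j) - s * y i"
            unfolding q_def using y(3)[OF i] by (simp add: pos_le_divide_eq)
          then show "(s + e) * y i \<le> (\<Sum>j<n. B $$ (i, j) * y j)"
            using e0 by (simp add: algebra_simps)
        qed (use s0 e0 y in auto)
        then show False
          using e0 s by simp
      next
        case False
        have "E y \<subseteq> {..<n}"
          unfolding E_def by auto
        then obtain a b where ab: "a \<in> E y" "b < n" "b \<notin> E y" "B $$ (a, b) \<noteq> 0"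
          using connected_onE[OF conn _ False ne] by metis
        have a: "a < n" "a \<noteq> b"
          using ab unfolding E_def by auto
        define d where "d = (\<Sum>j<n. B $$ (b, j) * y j) - s * y b"
        have d0: "0 < d"
          using ab sub[OF ab(2)] unfolding E_def d_def by auto
        \<comment> \<open>Raising \<open>y b\<close> by \<open>e\<close> raises the left side at
          \<open>b\<close> by \<open>s * e\<close>, which has to stay below the slack
          \<open>d\<close>. Dividing by \<open>s + 1\<close> also covers
          \<open>s = 0\<close>.\<close>
        define e where "e = d / (s + 1)"
        have e: "0 < e" "s * e < d"
          using d0 s0 by (auto simp: e_def field_simps)
        define z where "z = y(b := y b + e)"
        have sum_z: "(\<Sum>j<n. B $$ (i, j) * z j) = (\<Sum>j<n. B $$ (i, j) * y j) + B $$ (i, b) * e" for i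
          using ab(2) by (simp add: z_def sum.remove[of "{..<n}" b] algebra_simps)
        have inc: "(\<Sum>j<n. B $$ (i, j) * y j) \<le> (\<Sum>j<n. B $$ (i, j) * z j)" if "i < n" for i
          using B0[OF that ab(2)] e by (simp add: sum_z)
        have strict_b: "s * z b < (\<Sum>j<n. B $$ (b, j) * z j)"
          using inc[OF ab(2)] e by (simp add: z_def d_def algebra_simps)
        have strict_a: "s * z a < (\<Sum>j<n. B $$ (a, j) * z j)"
        proof -
          have "0 < B $$ (a, b) * e"
            using B0[OF a(1) ab(2)] ab(4) e by simp
          then show ?thesis
            unfolding sum_z using ab(1) a(2) by (simp add: z_def E_def)
        qed
        have sub_z: "s * z i \<le> (\<Sum>j<n. B $$ (i, j) * z j)" if "i < n" for i
          using strict_b inc[OF that] sub[OF that] by (cases "i = b") (auto simp: z_def)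
        have "E z \<subseteq> E y"
        proof
          fix i assume iz: "i \<in> E z"
          then have "i < n" "i \<noteq> b"
            using strict_b unfolding E_def by auto
          then show "i \<in> E y"
            using iz inc[of i] sub[of i] by (auto simp: E_def z_def)
        qed
        moreover have az: "a \<notin> E z"
          using strict_a unfolding E_def by auto
        ultimately have "card (E z) < card (E y)"
          using ab(1) finE by (intro psubset_card_mono) auto
        \<comment> \<open>The induction hypothesis turns every inequality for \<open>z\<close> into
          an equality, although the one at \<open>a\<close> has become strict.\<close>
        then have "E z = {..<n}"
        proof (rule less.hyps[OF _ y(1)])
          show "0 < z m" "\<And>i. i < n \<Longrightarrow> 0 \<le> z i"
            using y e by (auto simp: z_def add_nonneg_nonneg add_pos_pos)
        qed (rule sub_z)
        with az a show False
          by auto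
      qed
    qed
  qed
  then show ?thesis
    using i unfolding E_def by auto
qed

text \<open>Take an eigenvector for an eigenvalue of largest modulus. By the triangle inequality the
  moduli of its components satisfy the inequalities of \<open>subinvariant_eq\<close>, hence the
  eigenvalue equation for \<open>s\<close>. Connectivity then excludes zero components.\<close>

lemma perron_vector:
  fixes B :: "real mat"
  assumes B: "B \<in> carrier_mat n n" and n: "n > 0"
    and B0: "\<And>i j. i < n \<Longrightarrow> j < n \<Longrightarrow> 0 \<le> B $$ (i, j)"
    and conn: "connected_on n (\<lambda>i j. B $$ (i, j) \<noteq> 0)"
    and s: "s = spectral_radius (map_mat complex_of_real B)"
  obtains v where "\<And>i. i < n \<Longrightarrow> 0 < v i" "\<And>i. i < n \<Longrightarrow> (\<Sum>j<n. B $$ (i, j) * v j) = s * v i"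
proof -
  let ?A = "map_mat complex_of_real B"
  have A: "?A \<in> carrier_mat n n"
    using B by simp
  obtain l where l: "l \<in> spectrum ?A" "s = cmod l"
    unfolding s using spectral_radius_mem_max(1)[OF A n] by auto
  then obtain x where x: "x \<in> carrier_vec n" "x \<noteq> 0\<^sub>v n" "?A *\<^sub>v x = l \<cdot>\<^sub>v x"
    using B by (auto simp: spectrum_def eigenvalue_def eigenvector_def)
  obtain m where m: "m < n" "x $ m \<noteq> 0"
    using x(1,2) by (metis carrier_vecD eq_vecI index_zero_vec)
  define w where "w i = cmod (x $ i)" for i
  have w: "0 \<le> w i" for i
    by (simp add: w_def)
  have wm: "0 < w m"
    using m by (simp add: w_def)
  have sub: "s * w i \<le> (\<Sum>j<n. B $$ (i, j) * w j)" if i: "i < n" for i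
  proof -
    have "(?A *\<^sub>v x) $ i = (\<Sum>j<n. complex_of_real (B $$ (i, j)) * x $ j)"
      using i B x(1) by (simp add: scalar_prod_def atLeast0LessThan)
    then have "l * x $ i = (\<Sum>j<n. complex_of_real (B $$ (i, j)) * x $ j)"
      using i x(1) by (simp add: x(3))
    then have "s * w i = cmod (\<Sum>j<n. complex_of_real (B $$ (i, j)) * x $ j)"
      by (metis l(2) norm_mult w_def)
    also have "\<dots> \<le> (\<Sum>j<n. B $$ (i, j) * w j)"
      using B0 i by (intro sum_norm_le) (auto simp: norm_mult w_def)
    finally show ?thesis .
  qed
  have eq: "(\<Sum>j<n. B $$ (i, j) * w j) = s * w i" if "i < n" for i
    by (rule subinvariant_eq[OF B B0 conn s m(1), where y = w]) (use wm w sub that in auto)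
  have pos: "0 < w i" if i: "i < n" for i
  proof (rule ccontr)
    assume "\<not> 0 < w i"
    define S where "S = {i. i < n \<and> w i = 0}"
    have "w i = 0"
      using \<open>\<not> 0 < w i\<close> w[of i] by simp
    then have "i \<in> S" "m \<notin> S"
      using i wm by (simp_all add: S_def)
    then have S: "S \<subseteq> {..<n}" "S \<noteq> {}" "S \<noteq> {..<n}"
      using m(1) by (auto simp: S_def)
    \<comment> \<open>The nonnegative terms of row \<open>a\<close> sum to
      \<open>s * w a = 0\<close>, so all of them vanish; but both factors of the term at
      \<open>b\<close> are nonzero.\<close>
    obtain a b where ab: "a \<in> S" "b < n" "b \<notin> S" "B $$ (a, b) \<noteq> 0"
      using connected_onE[OF conn S] by metis
    have a: "a < n" "w a = 0"
      using ab(1) by (auto simp: S_def)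
    have "0 \<le> B $$ (a, j) * w j" if "j < n" for j
      using B0[OF a(1) that] w by simp
    then have "B $$ (a, b) * w b = 0"
      using eq[OF a(1)] a(2) ab(2) sum_nonneg_eq_0_iff[of "{..<n}" "\<lambda>j. B $$ (a, j) * w j"] by auto
    then show False
      using ab by (auto simp: S_def)
  qed
  show ?thesis
    by (rule that[OF pos eq])
qed

section \<open>The equality case of the maximum principle\<close>

text \<open>Where \<open>cmod (y i)\<close> is maximal, the triangle inequality for row
  \<open>i\<close> must be an equality, so each term points in the direction of \<open>y i\<close>
  and has its full length. Along an edge with \<open>q i j \<noteq> 0\<close> this makes
  \<open>cmod (y j)\<close> maximal too, and connectivity spreads it to all indices.\<close>

lemma maximum_principle_eq:
  fixes p :: "nat \<Rightarrow> nat \<Rightarrow> complex" and q :: "nat \<Rightarrow> nat \<Rightarrow> real" and y :: "nat \<Rightarrow> complex"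
  assumes conn: "connected_on n (\<lambda>i j. q i j \<noteq> 0)"
    and sum_q: "\<And>i. i < n \<Longrightarrow> (\<Sum>j\<in>{..<n} - {i}. q i j) = 1"
    and p_q: "\<And>i j. i < n \<Longrightarrow> j < n \<Longrightarrow> cmod (p i j) \<le> q i j"
    and y: "m < n" "y m \<noteq> 0"
    and eq: "\<And>i. i < n \<Longrightarrow> y i = (\<Sum>j\<in>{..<n} - {i}. p i j * y j)"
  obtains M where "0 < M" "\<And>i. i < n \<Longrightarrow> cmod (y i) = M"
    "\<And>i j. i < n \<Longrightarrow> j < n \<Longrightarrow> i \<noteq> j \<Longrightarrow> p i j * y j = complex_of_real (q i j) * y i"
proof -
  define M where "M = Max ((\<lambda>i. cmod (y i)) ` {..<n})"
  have le: "cmod (y i) \<le> M" if "i < n" for i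
    unfolding M_def using that by (intro Max_ge) auto
  have M0: "0 < M"
    using le[OF y(1)] y(2) by (meson less_le_trans zero_less_norm_iff)
  define S where "S = {i. i < n \<and> cmod (y i) = M}"
  have "M \<in> (\<lambda>i. cmod (y i)) ` {..<n}"
    unfolding M_def using y(1) by (intro Max_in) auto
  then have S: "S \<subseteq> {..<n}" "S \<noteq> {}"
    unfolding S_def by auto
  have key: "p i j * y j = complex_of_real (q i j) * y i" if i: "i \<in> S" and j: "j < n" "i \<noteq> j" for i j
  proof -
    have iM: "i < n" "cmod (y i) = M" "y i \<noteq> 0"
      using i M0 unfolding S_def by auto
    \<comment> \<open>Dividing by \<open>y i\<close> rotates the common direction onto the positive
      real axis: the \<open>c j\<close> sum to 1 and have moduli at most \<open>q i j\<close>, which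
      sum to 1 as well. Hence every real part equals its bound.\<close>
    define c where "c j = p i j * y j / y i" for j
    have c_le: "cmod (c j) \<le> q i j" if "j < n" for j
    proof -
      have "cmod (p i j) * cmod (y j) \<le> q i j * M"
        using p_q[OF iM(1) that] le[OF that] by (intro mult_mono) (auto intro: order_trans[OF norm_ge_zero])
      then show ?thesis
        using M0 iM by (simp add: c_def norm_mult norm_divide pos_divide_le_eq)
    qed
    have Re_le: "Re (c j) \<le> q i j" if "j < n" for j
      using c_le[OF that] complex_Re_le_cmod order_trans by blast
    have "(\<Sum>j\<in>{..<n} - {i}. c j) = (\<Sum>j\<in>{..<n} - {i}. p i j * y j) / y i"
      by (simp add: c_def sum_divide_distrib)
    also have "\<dots> = 1"
      unfolding eq[OF iM(1), symmetric] using iM by simp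
    finally have "(\<Sum>j\<in>{..<n} - {i}. Re (c j)) = 1"
      by (metis Re_sum one_complex.sel(1))
    then have "(\<Sum>j\<in>{..<n} - {i}. q i j - Re (c j)) = 0"
      using sum_q[OF iM(1)] by (simp add: sum_subtractf)
    then have Re_c: "Re (c j) = q i j"
      using sum_nonneg_eq_0_iff[of "{..<n} - {i}" "\<lambda>j. q i j - Re (c j)"] Re_le j by auto
    \<comment> \<open>The real part already exhausts the modulus, so no imaginary part is
      left.\<close>
    have "(Re (c j))\<^sup>2 + (Im (c j))\<^sup>2 \<le> (q i j)\<^sup>2"
      unfolding cmod_power2[symmetric] using c_le[OF j(1)] by (intro power_mono) auto
    then have "c j = complex_of_real (q i j)"
      using Re_c by (simp add: complex_eq_iff)
    then show ?thesis
      using iM unfolding c_def by (simp add: field_simps)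
  qed
  have "S = {..<n}"
  proof (rule ccontr)
    assume "S \<noteq> {..<n}"
    then obtain i j where ij: "i \<in> S" "j < n" "j \<notin> S" "q i j \<noteq> 0"
      using connected_onE[OF conn S] by metis
    then have i: "i < n" "cmod (y i) = M" "i \<noteq> j"
      unfolding S_def by auto
    have q: "0 < q i j"
      using p_q[OF i(1) ij(2)] ij(4) norm_ge_zero[of "p i j"] by linarith
    have "q i j * M = cmod (p i j) * cmod (y j)"
      using arg_cong[OF key[OF ij(1,2) i(3)], of cmod] i q by (simp add: norm_mult)
    also have "\<dots> \<le> q i j * cmod (y j)"
      using p_q[OF i(1) ij(2)] by (intro mult_right_mono) auto
    finally have "M \<le> cmod (y j)"
      using q by simp
    then show False
      using le[OF ij(2)] ij unfolding S_def by auto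
  qed
  then show ?thesis
    by (intro that[OF M0]) (use key in \<open>auto simp: S_def\<close>)
qed

section \<open>Ray patterns\<close>

lemma rcong_2pi_iff: "[a = b] (rmod (2 * pi)) \<longleftrightarrow> cis (a - b) = 1"
proof
  assume "[a = b] (rmod (2 * pi))"
  then obtain k :: int where "b = a + of_int k * (2 * pi)"
    unfolding rcong_altdef by blast
  then have "a - b = 2 * pi * of_int (- k)"
    by simp
  then show "cis (a - b) = 1"
    by (simp only: cis_multiple_2pi Ints_of_int)
next
  assume "cis (a - b) = 1"
  then have "cos (a - b) = 1"
    by (simp add: complex_eq_iff)
  then obtain k :: int where "a - b = of_int k * 2 * pi"
    unfolding cos_one_2pi_int by blast
  then have "b = a + of_int (- k) * (2 * pi)"
    by simp
  then show "[a = b] (rmod (2 * pi))"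
    unfolding rcong_altdef by blast
qed

lemma cis_eq_1_uminus: "cis (- a) = 1 \<longleftrightarrow> cis a = 1"
  by (auto simp: complex_eq_iff)

text \<open>The ray pattern conditions say exactly that, up to a unitary diagonal similarity by
  \<open>cis \<theta>\<close>, all entries above the diagonal have argument \<open>pi\<close> and all entries below it have
  argument \<open>pi + \<phi>\<close>.\<close>

lemma ray_classI:
  assumes B: "B \<in> carrier_mat n n" and diag: "\<And>i. i < n \<Longrightarrow> B $$ (i, i) = 1"
    and form: "\<And>i j. i < n \<Longrightarrow> j < n \<Longrightarrow> i \<noteq> j \<Longrightarrow> B $$ (i, j) =
      - complex_of_real (cmod (B $$ (i, j))) * cis (\<theta> i - \<theta> j + (if j < i then \<phi> else 0))"
  shows "B \<in> ray_class \<phi> n"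
proof -
  define f where "f r s = (if r = s then 0 else pi + \<theta> r - \<theta> s + (if s < r then \<phi> else 0))" for r s
  define P where "P = mat n n (\<lambda>(r, s). exp (\<i> * complex_of_real (f r s)))"
  \<comment> \<open>In every order of the indices \<open>\<theta>\<close> and \<open>\<phi>\<close>
    cancel from the pattern conditions, and one of these multiples of \<open>2 * pi\<close>
    remains.\<close>
  have cis0: "cis x = 1" if "x = 0 \<or> x = 2 * pi \<or> x = - (2 * pi)" for x
    using that by (auto simp: complex_eq_iff)
  have "ray_pattern_mat \<phi> n P"
    unfolding ray_pattern_mat_def rcong_2pi_iff
  proof (intro exI[of _ f] conjI allI impI P_def)
    fix r s :: nat assume "r \<noteq> s"
    then show "cis (f r s + f s r - \<phi>) = 1"
      by (intro cis0) (auto simp: f_def)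
  next
    fix r s t :: nat assume "r < s \<and> s < t \<or> s < t \<and> t < r \<or> t < r \<and> r < s"
    then show "cis (f r s - f r t - (f t s - \<phi> + pi)) = 1"
      by (intro cis0) (auto simp: f_def)
  next
    fix r s t :: nat assume "r < t \<and> t < s \<or> t < s \<and> s < r \<or> s < r \<and> r < t"
    then show "cis (f r s - f r t - (f t s + pi)) = 1"
      by (intro cis0) (auto simp: f_def)
  qed (simp add: f_def)
  \<comment> \<open>The global phase \<open>\<eta>\<close> can be 0 because the diagonals of
    \<open>B\<close> and \<open>P\<close> are both 1.\<close>
  moreover have "B $$ (r, s) = exp (\<i> * complex_of_real 0) * complex_of_real (cmod (B $$ (r, s))) * P $$ (r, s)"
    if rs: "r < n" "s < n" for r s
  proof (cases "r = s")
    case True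
    then show ?thesis
      using rs diag by (simp add: P_def f_def)
  next
    case False
    have "f r s = pi + (\<theta> r - \<theta> s + (if s < r then \<phi> else 0))"
      using False by (simp add: f_def)
    then have "cis (f r s) = - cis (\<theta> r - \<theta> s + (if s < r then \<phi> else 0))"
      by (simp only: cis_mult[symmetric] cis_pi) simp
    then have "P $$ (r, s) = - cis (\<theta> r - \<theta> s + (if s < r then \<phi> else 0))"
      using rs by (simp add: P_def cis_conv_exp)
    then show ?thesis
      using form[OF rs False] by simp
  qed
  ultimately show ?thesis
    unfolding ray_class_def using B by blast
qed

text \<open>Row 0 of the pattern determines \<open>\<theta>\<close>. Condition (1) then fixes column
  0, and conditions (2) and (3) with \<open>r = 0\<close> fix the remaining entries below and above
  the diagonal, respectively.\<close>

lemma ray_classE: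
  assumes B: "B \<in> ray_class \<phi> n" and n: "0 < n" and diag: "\<And>i. i < n \<Longrightarrow> B $$ (i, i) = 1"
  obtains \<theta> where "\<And>i j. i < n \<Longrightarrow> j < n \<Longrightarrow> i \<noteq> j \<Longrightarrow> B $$ (i, j) =
      - complex_of_real (cmod (B $$ (i, j))) * cis (\<theta> i - \<theta> j + (if j < i then \<phi> else 0))"
proof -
  obtain \<eta> P where P: "ray_pattern_mat \<phi> n P"
    and ent: "\<And>r s. r < n \<Longrightarrow> s < n \<Longrightarrow> B $$ (r, s) =
       exp (\<i> * complex_of_real \<eta>) * complex_of_real (cmod (B $$ (r, s))) * P $$ (r, s)"
    using B unfolding ray_class_def by blast
  obtain f where P_def: "P = mat n n (\<lambda>(r, s). exp (\<i> * complex_of_real (f r s)))"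
    and f1: "\<forall>r<n. \<forall>s<n. r \<noteq> s \<longrightarrow> cis (f r s + f s r - \<phi>) = 1"
    and f2: "\<forall>r<n. \<forall>s<n. \<forall>t<n. r < s \<and> s < t \<or> s < t \<and> t < r \<or> t < r \<and> r < s \<longrightarrow>
      cis (f r s - f r t - (f t s - \<phi> + pi)) = 1"
    and f3: "\<forall>r<n. \<forall>s<n. \<forall>t<n. r < t \<and> t < s \<or> t < s \<and> s < r \<or> s < r \<and> r < t \<longrightarrow>
      cis (f r s - f r t - (f t s + pi)) = 1"
    and f4: "\<forall>r<n. cis (f r r - 0) = 1"
    using P unfolding ray_pattern_mat_def rcong_2pi_iff by (elim exE conjE) (rule that)
  have Pf: "P $$ (r, s) = cis (f r s)" if "r < n" "s < n" for r s
    using that by (simp add: P_def cis_conv_exp)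
  \<comment> \<open>Entry (0, 0) is 1 in both \<open>B\<close> and the pattern, which leaves no room
    for a global phase.\<close>
  have \<eta>: "exp (\<i> * complex_of_real \<eta>) = 1"
    using ent[OF n n] diag[OF n] Pf[OF n n] f4 n by simp
  have shift: "cis (x - 2 * pi) = cis x" for x
    by (simp add: cis_divide[symmetric])
  \<comment> \<open>Solves \<open>f 0 r = pi + \<theta> 0 - \<theta> r\<close> for
    \<open>\<theta> r\<close>, with \<open>\<theta> 0\<close> normalised to 0.\<close>
  define \<theta> where "\<theta> r = (if r = 0 then 0 else pi - f 0 r)" for r :: nat
  have main: "cis (f i j - (pi + (\<theta> i - \<theta> j + (if j < i then \<phi> else 0)))) = 1"
    if ij: "i < n" "j < n" "i \<noteq> j" for i j
  proof -
    consider "i = 0" | "j = 0" | "0 < j" "j < i" | "0 < i" "i < j"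
      using ij by fastforce
    then show ?thesis
    proof cases
      case 1
      then show ?thesis using ij by (simp add: \<theta>_def)
    next
      case 2
      have "f i j - (pi + (\<theta> i - \<theta> j + (if j < i then \<phi> else 0))) = f i j + f j i - \<phi> - 2 * pi"
        using 2 ij by (simp add: \<theta>_def)
      moreover have "cis (f i j + f j i - \<phi>) = 1"
        using f1 ij by blast
      ultimately show ?thesis
        by (simp only: shift)
    next
      case 3
      have "f i j - (pi + (\<theta> i - \<theta> j + (if j < i then \<phi> else 0))) =
          - (f 0 j - f 0 i - (f i j - \<phi> + pi)) - 2 * pi"
        using 3 by (simp add: \<theta>_def)
      moreover have "cis (- (f 0 j - f 0 i - (f i j - \<phi> + pi))) = 1"
        unfolding cis_eq_1_uminus using 3 ij n f2[rule_format, of 0 j i] by blast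
      ultimately show ?thesis
        by (simp only: shift)
    next
      case 4
      have "f i j - (pi + (\<theta> i - \<theta> j + (if j < i then \<phi> else 0))) =
          - (f 0 j - f 0 i - (f i j + pi)) - 2 * pi"
        using 4 by (simp add: \<theta>_def)
      moreover have "cis (- (f 0 j - f 0 i - (f i j + pi))) = 1"
        unfolding cis_eq_1_uminus using 4 ij n f3[rule_format, of 0 j i] by blast
      ultimately show ?thesis
        by (simp only: shift)
    qed
  qed
  show ?thesis
  proof (rule that)
    fix i j assume ij: "i < n" "j < n" "i \<noteq> j"
    let ?t = "\<theta> i - \<theta> j + (if j < i then \<phi> else 0)"
    have "cis (f i j) = cis (f i j - (pi + ?t)) * cis (pi + ?t)"
      by (simp add: cis_mult)
    also have "\<dots> = - cis ?t"
      unfolding main[OF ij] by (simp add: cis_mult[symmetric])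
    finally have "P $$ (i, j) = - cis ?t"
      using Pf[OF ij(1,2)] by simp
    then show "B $$ (i, j) = - complex_of_real (cmod (B $$ (i, j))) * cis ?t"
      using ent[OF ij(1,2)] \<eta> by simp
  qed
qed

section \<open>The backward Gauss-Seidel iteration\<close>

lemma mat_inv:
  fixes A :: "'a :: field mat"
  assumes A: "A \<in> carrier_mat n n" and det: "det A \<noteq> 0"
  shows mat_inv_carrier: "mat_inv A \<in> carrier_mat n n"
    and mat_inv_left: "mat_inv A * A = 1\<^sub>m n"
    and mat_inv_right: "A * mat_inv A = 1\<^sub>m n"
proof -
  have "mat_inverse A \<noteq> None"
    using mat_inverse(1)[OF A, where b = "()"] det_non_zero_imp_unit[OF A det, where b = "()"] by blast
  then obtain C where "mat_inverse A = Some C"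
    by blast
  then have "A * mat_inv A = 1\<^sub>m n \<and> mat_inv A * A = 1\<^sub>m n \<and> mat_inv A \<in> carrier_mat n n"
    using mat_inverse(2)[OF A] by (simp add: mat_inv_def)
  then show "mat_inv A \<in> carrier_mat n n" "mat_inv A * A = 1\<^sub>m n" "A * mat_inv A = 1\<^sub>m n"
    by blast+
qed

lemma det_upper_triangular_nonzero:
  fixes A :: "'a :: idom mat"
  assumes A: "A \<in> carrier_mat n n" and "upper_triangular A" "\<And>i. i < n \<Longrightarrow> A $$ (i, i) \<noteq> 0"
  shows "det A \<noteq> 0"
  using assms by (subst det_upper_triangular[of A n]) (auto simp: prod_list_zero_iff diag_mat_def)

locale nonzero_diagonal =
  fixes n :: nat and A :: "complex mat"
  assumes A: "A \<in> carrier_mat n n" and n_pos: "0 < n"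
    and diag: "\<And>i. i < n \<Longrightarrow> A $$ (i, i) \<noteq> 0"
begin

abbreviation "M \<equiv> diag_part A - upper_part A"
abbreviation "L \<equiv> lower_part A"
abbreviation "H \<equiv> BGS_mat A"

lemma M: "M \<in> carrier_mat n n" and L: "L \<in> carrier_mat n n"
  using A by (auto simp: diag_part_def upper_part_def lower_part_def mat_diag_def)

lemma A_eq: "A = M - L"
  using A by (intro eq_matI) (auto simp: diag_part_def lower_part_def upper_part_def mat_diag_def)

lemma det_M: "det M \<noteq> 0"
proof (rule det_upper_triangular_nonzero[OF M])
  show "upper_triangular M"
    using A by (auto simp: diag_part_def upper_part_def mat_diag_def)
  show "M $$ (i, i) \<noteq> 0" if "i < n" for i
    using A diag[OF that] that by (simp add: diag_part_def upper_part_def mat_diag_def)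
qed

lemma H: "H \<in> carrier_mat n n"
  using mat_inv_carrier[OF M det_M] L by (simp add: BGS_mat_def)

lemma mat_inv_M_mult_vec: "x \<in> carrier_vec n \<Longrightarrow> mat_inv M *\<^sub>v (M *\<^sub>v x) = x"
  using assoc_mult_mat_vec[OF mat_inv_carrier[OF M det_M] M, of x] mat_inv_left[OF M det_M] by simp

lemma M_mult_mat_inv_vec: "x \<in> carrier_vec n \<Longrightarrow> M *\<^sub>v (mat_inv M *\<^sub>v x) = x"
  using assoc_mult_mat_vec[OF M mat_inv_carrier[OF M det_M], of x] mat_inv_right[OF M det_M] by simp

lemma H_mult_vec: "x \<in> carrier_vec n \<Longrightarrow> H *\<^sub>v x = mat_inv M *\<^sub>v (L *\<^sub>v x)"
  unfolding BGS_mat_def by (rule assoc_mult_mat_vec[OF mat_inv_carrier[OF M det_M] L])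

text \<open>Multiplying by \<open>M\<close> removes the inverse: the equation becomes
  \<open>L *\<^sub>v x = l \<cdot>\<^sub>v (M *\<^sub>v x)\<close>, in which \<open>l\<close>
  multiplies the entries on and above the diagonal but not those below it.\<close>

lemma H_eigen_iff:
  assumes x: "x \<in> carrier_vec n"
  shows "H *\<^sub>v x = l \<cdot>\<^sub>v x \<longleftrightarrow>
    (\<forall>i<n. l * A $$ (i, i) * x $ i = - (\<Sum>j\<in>{..<n} - {i}. A $$ (i, j) * (if j < i then 1 else l) * x $ j))"
proof -
  have Mx: "M *\<^sub>v (l \<cdot>\<^sub>v x) = l \<cdot>\<^sub>v (M *\<^sub>v x)"
    by (rule mult_mat_vec[OF M x])
  have "H *\<^sub>v x = l \<cdot>\<^sub>v x \<longleftrightarrow> L *\<^sub>v x = l \<cdot>\<^sub>v (M *\<^sub>v x)"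
  proof
    assume "H *\<^sub>v x = l \<cdot>\<^sub>v x"
    then have "M *\<^sub>v (mat_inv M *\<^sub>v (L *\<^sub>v x)) = l \<cdot>\<^sub>v (M *\<^sub>v x)"
      using H_mult_vec[OF x] Mx by simp
    then show "L *\<^sub>v x = l \<cdot>\<^sub>v (M *\<^sub>v x)"
      using M_mult_mat_inv_vec[of "L *\<^sub>v x"] L x by simp
  next
    assume "L *\<^sub>v x = l \<cdot>\<^sub>v (M *\<^sub>v x)"
    then have "H *\<^sub>v x = mat_inv M *\<^sub>v (M *\<^sub>v (l \<cdot>\<^sub>v x))"
      using H_mult_vec[OF x] Mx by simp
    then show "H *\<^sub>v x = l \<cdot>\<^sub>v x"
      using mat_inv_M_mult_vec[of "l \<cdot>\<^sub>v x"] x by simp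
  qed
  also have "\<dots> \<longleftrightarrow> (\<forall>i<n. (L *\<^sub>v x) $ i = l * (M *\<^sub>v x) $ i)"
    using L M x by (auto simp: vec_eq_iff simp del: index_mult_mat_vec)
  also have "\<dots> \<longleftrightarrow> (\<forall>i<n. l * A $$ (i, i) * x $ i =
      - (\<Sum>j\<in>{..<n} - {i}. A $$ (i, j) * (if j < i then 1 else l) * x $ j))"
  proof (intro all_cong1 imp_cong refl)
    fix i assume i: "i < n"
    have Lx: "(L *\<^sub>v x) $ i = (\<Sum>j\<in>{..<n} - {i}. (if j < i then - A $$ (i, j) * x $ j else 0))"
    proof -
      have "(L *\<^sub>v x) $ i = (\<Sum>j<n. (if j < i then - A $$ (i, j) * x $ j else 0))"
        using A x i by (auto simp: lower_part_def scalar_prod_def atLeast0LessThan intro!: sum.cong)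
      then show ?thesis
        using i by (simp add: sum.remove[of "{..<n}" i])
    qed
    have Mx: "(M *\<^sub>v x) $ i = A $$ (i, i) * x $ i +
        (\<Sum>j\<in>{..<n} - {i}. (if i < j then A $$ (i, j) * x $ j else 0))"
    proof -
      have "(M *\<^sub>v x) $ i = (\<Sum>j<n. (if i = j then A $$ (i, i) * x $ i else
          if i < j then A $$ (i, j) * x $ j else 0))"
        using A x i by (auto simp: diag_part_def upper_part_def mat_diag_def scalar_prod_def
            atLeast0LessThan intro!: sum.cong)
      also have "\<dots> = A $$ (i, i) * x $ i + (\<Sum>j\<in>{..<n} - {i}. (if i = j then A $$ (i, i) * x $ i else
          if i < j then A $$ (i, j) * x $ j else 0))"
        using i by (simp add: sum.remove[of "{..<n}" i])
      also have "(\<Sum>j\<in>{..<n} - {i}. (if i = j then A $$ (i, i) * x $ i else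
          if i < j then A $$ (i, j) * x $ j else 0)) =
          (\<Sum>j\<in>{..<n} - {i}. (if i < j then A $$ (i, j) * x $ j else 0))"
        by (intro sum.cong) auto
      finally show ?thesis .
    qed
    have aux: "c = l * (d + u) \<longleftrightarrow> l * d = - (l * u - c)" for c d u
      by (auto simp: algebra_simps)
    have S: "(\<Sum>j\<in>{..<n} - {i}. A $$ (i, j) * (if j < i then 1 else l) * x $ j) =
        l * (\<Sum>j\<in>{..<n} - {i}. (if i < j then A $$ (i, j) * x $ j else 0)) -
        (\<Sum>j\<in>{..<n} - {i}. (if j < i then - A $$ (i, j) * x $ j else 0))"
      unfolding sum_distrib_left sum_subtractf[symmetric] by (intro sum.cong) auto
    show "((L *\<^sub>v x) $ i = l * (M *\<^sub>v x) $ i) = (l * A $$ (i, i) * x $ i =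
        - (\<Sum>j\<in>{..<n} - {i}. A $$ (i, j) * (if j < i then 1 else l) * x $ j))"
      unfolding Lx Mx S mult.assoc[of l] by (rule aux)
  qed
  finally show ?thesis .
qed

section \<open>Error propagation and convergence of the iterates\<close>

text \<open>A solution is a fixed point of the iteration, so each step multiplies the error by
  \<open>H\<close>.\<close>

lemma BGS_seq_eq:
  assumes x: "x \<in> carrier_vec n" "A *\<^sub>v x = b" and x0: "x0 \<in> carrier_vec n"
  shows "BGS_seq A b x0 k = x + H ^\<^sub>m k *\<^sub>v (x0 - x)"
proof (induction k)
  case 0
  then show ?case
    using H x x0 by (auto intro!: eq_vecI)
next
  case (Suc k)
  have d: "x0 - x \<in> carrier_vec n"
    using x x0 by simp
  have Hd: "H ^\<^sub>m k *\<^sub>v (x0 - x) \<in> carrier_vec n"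
    using H d by (meson mult_mat_vec_carrier pow_carrier_mat)
  have Lx: "L *\<^sub>v x \<in> carrier_vec n" and Mx: "M *\<^sub>v x \<in> carrier_vec n"
    using L M x by auto
  have add_diff: "u + (w - u) = w" if "u \<in> carrier_vec n" "w \<in> carrier_vec n" for u w :: "complex vec"
    using that by (intro eq_vecI) auto
  have swap: "(u + w) + z = (u + z) + w"
    if "u \<in> carrier_vec n" "w \<in> carrier_vec n" "z \<in> carrier_vec n" for u w z :: "complex vec"
    using that by (intro eq_vecI) auto
  \<comment> \<open>By the splitting, \<open>A *\<^sub>v x = b\<close> says that
    \<open>M *\<^sub>v x\<close> is \<open>L *\<^sub>v x + b\<close>; applying
    \<open>mat_inv M\<close> gives the fixed point equation.\<close>
  have "b = M *\<^sub>v x - L *\<^sub>v x"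
    using minus_mult_distrib_mat_vec[OF M L x(1)] A_eq x(2) by simp
  then have "L *\<^sub>v x + b = M *\<^sub>v x"
    using add_diff[OF Lx Mx] by simp
  moreover have b: "b \<in> carrier_vec n"
    using x A by auto
  ultimately have fix_x: "H *\<^sub>v x + mat_inv M *\<^sub>v b = x"
    using mult_add_distrib_mat_vec[OF mat_inv_carrier[OF M det_M] Lx b]
      mat_inv_M_mult_vec[OF x(1)] H_mult_vec[OF x(1)] by simp
  have Mb: "mat_inv M *\<^sub>v b \<in> carrier_vec n"
    using mat_inv_carrier[OF M det_M] b by auto
  have Hx: "H *\<^sub>v x \<in> carrier_vec n" and HHd: "H *\<^sub>v (H ^\<^sub>m k *\<^sub>v (x0 - x)) \<in> carrier_vec n"
    using H x Hd by auto
  have "BGS_seq A b x0 (Suc k) = H *\<^sub>v (x + H ^\<^sub>m k *\<^sub>v (x0 - x)) + mat_inv M *\<^sub>v b"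
    using Suc by simp
  also have "\<dots> = (H *\<^sub>v x + H *\<^sub>v (H ^\<^sub>m k *\<^sub>v (x0 - x))) + mat_inv M *\<^sub>v b"
    using mult_add_distrib_mat_vec[OF H x(1) Hd] by simp
  also have "\<dots> = (H *\<^sub>v x + mat_inv M *\<^sub>v b) + H *\<^sub>v (H ^\<^sub>m k *\<^sub>v (x0 - x))"
    by (rule swap[OF Hx HHd Mb])
  also have "H *\<^sub>v (H ^\<^sub>m k *\<^sub>v (x0 - x)) = H ^\<^sub>m Suc k *\<^sub>v (x0 - x)"
    unfolding pow_mat_Suc_left[OF H]
    by (rule assoc_mult_mat_vec[OF H pow_carrier_mat[OF H] d, symmetric])
  finally show ?case
    unfolding fix_x .
qed

text \<open>If the spectral radius is below 1, then 1 is not an eigenvalue of \<open>H\<close>,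
  which makes \<open>A\<close> invertible, and the error tends to 0. Conversely, an initial error
  along an eigenvector of largest modulus decays only if that modulus is below 1.\<close>

lemma spectral_radius_less_1_iff_converges:
  assumes b: "b \<in> carrier_vec n"
  shows "spectral_radius H < 1 \<longleftrightarrow> BGS_converges n A b"
proof
  assume sr: "spectral_radius H < 1"
  have det_A: "det A \<noteq> 0"
  proof
    assume "det A = 0"
    then obtain v where v: "v \<in> carrier_vec n" "v \<noteq> 0\<^sub>v n" "A *\<^sub>v v = 0\<^sub>v n"
      using det_0_iff_vec_prod_zero[OF A] by auto
    \<comment> \<open>A vector in the kernel of \<open>A\<close> is fixed by \<open>H\<close>, so 1
      would be an eigenvalue.\<close>
    have "M *\<^sub>v v - L *\<^sub>v v = 0\<^sub>v n"
      using minus_mult_distrib_mat_vec[OF M L v(1)] A_eq v(3) by simp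
    then have "L *\<^sub>v v = M *\<^sub>v v"
      using L M v(1) by (auto simp: vec_eq_iff simp del: index_mult_mat_vec)
    then have "H *\<^sub>v v = 1 \<cdot>\<^sub>v v"
      using H_mult_vec[OF v(1)] mat_inv_M_mult_vec[OF v(1)] by simp
    then have "1 \<in> spectrum H"
      using H v by (auto simp: spectrum_def eigenvalue_def eigenvector_def)
    then have "cmod 1 \<le> spectral_radius H"
      by (intro spectral_radius_mem_max(2)[OF H n_pos] imageI)
    then show False
      using sr by simp
  qed
  define x where "x = mat_inv A *\<^sub>v b"
  have x: "x \<in> carrier_vec n"
    using mat_inv_carrier[OF A det_A] b by (auto simp: x_def)
  have Ax: "A *\<^sub>v x = b"
    using assoc_mult_mat_vec[OF A mat_inv_carrier[OF A det_A] b] mat_inv_right[OF A det_A] b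
    by (simp add: x_def)
  have "y = x" if "y \<in> carrier_vec n" "A *\<^sub>v y = b" for y
    using assoc_mult_mat_vec[OF mat_inv_carrier[OF A det_A] A that(1)] mat_inv_left[OF A det_A] that
    by (simp add: x_def)
  then have "{y \<in> carrier_vec n. A *\<^sub>v y = b} = {x}"
    using x Ax by blast
  moreover have "vec_tendsto n (BGS_seq A b x0) x" if x0: "x0 \<in> carrier_vec n" for x0
    unfolding vec_tendsto_def
  proof (intro allI impI)
    fix j assume j: "j < n"
    have d: "x0 - x \<in> carrier_vec n"
      using x x0 by simp
    have "(\<lambda>k. x $ j + (H ^\<^sub>m k *\<^sub>v (x0 - x)) $ j) \<longlonglongrightarrow> x $ j + 0"
      by (intro tendsto_add tendsto_const pow_mat_vec_tendsto_0[OF H n_pos sr d j])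
    moreover have "BGS_seq A b x0 k $ j = x $ j + (H ^\<^sub>m k *\<^sub>v (x0 - x)) $ j" for k
      unfolding BGS_seq_eq[OF x Ax x0] using H j by (intro index_add_vec) simp
    ultimately show "(\<lambda>k. BGS_seq A b x0 k $ j) \<longlonglongrightarrow> x $ j"
      by simp
  qed
  ultimately show "BGS_converges n A b"
    unfolding BGS_converges_def by blast
next
  assume "BGS_converges n A b"
  then obtain x where x: "{y \<in> carrier_vec n. A *\<^sub>v y = b} = {x}"
    and conv: "\<And>x0. x0 \<in> carrier_vec n \<Longrightarrow> vec_tendsto n (BGS_seq A b x0) x"
    unfolding BGS_converges_def by blast
  have xc: "x \<in> carrier_vec n" and Ax: "A *\<^sub>v x = b"
    using x by auto
  obtain l where l: "l \<in> spectrum H" "spectral_radius H = cmod l"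
    using spectral_radius_mem_max(1)[OF H n_pos] by auto
  then obtain v where ev: "eigenvector H v l"
    by (auto simp: spectrum_def eigenvalue_def)
  then have v: "v \<in> carrier_vec n" "v \<noteq> 0\<^sub>v n"
    using H by (auto simp: eigenvector_def)
  obtain j where j: "j < n" "v $ j \<noteq> 0"
    using v by (metis carrier_vecD eq_vecI index_zero_vec)
  have vx: "v + x \<in> carrier_vec n" "(v + x) - x = v"
    using v xc by (auto intro!: eq_vecI)
  \<comment> \<open>Started at \<open>v + x\<close>, the iteration has error \<open>l ^ k\<close>
    times \<open>v\<close>; the component \<open>j\<close>, where \<open>v\<close> does not vanish,
    isolates \<open>l ^ k\<close>.\<close>
  have seq: "BGS_seq A b (v + x) k $ j = x $ j + l ^ k * v $ j" for k
    unfolding BGS_seq_eq[OF xc Ax vx(1)] vx(2) eigenvector_pow[OF H ev] using v xc j by simp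
  have "(\<lambda>k. BGS_seq A b (v + x) k $ j) \<longlonglongrightarrow> x $ j"
    using conv[OF vx(1)] j(1) unfolding vec_tendsto_def by blast
  then have "(\<lambda>k. x $ j + l ^ k * v $ j) \<longlonglongrightarrow> x $ j"
    by (simp only: seq)
  then have "(\<lambda>k. ((x $ j + l ^ k * v $ j) - x $ j) / v $ j) \<longlonglongrightarrow> (x $ j - x $ j) / v $ j"
    by (intro tendsto_intros j)
  then have "(\<lambda>k. l ^ k) \<longlonglongrightarrow> 0"
    using j by simp
  then have "(\<lambda>k. cmod l ^ k) \<longlonglongrightarrow> 0"
    using tendsto_norm_zero by (fastforce simp: norm_power)
  then have "cmod l < 1"
    using LIMSEQ_le_const[of "\<lambda>k. cmod l ^ k" 0 1] one_le_power[of "cmod l"] by fastforce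
  then show "spectral_radius H < 1"
    using l by simp
qed

section \<open>Eigenvalues outside the open unit disc and ray patterns\<close>

abbreviation "B \<equiv> mat_inv (diag_part A) * A"

lemma B: "B \<in> carrier_mat n n" and B_index: "\<And>i j. i < n \<Longrightarrow> j < n \<Longrightarrow> B $$ (i, j) = A $$ (i, j) / A $$ (i, i)"
proof -
  have D: "diag_part A = mat_diag n (\<lambda>i. A $$ (i, i))"
    using A by (simp add: diag_part_def)
  then have Dc: "diag_part A \<in> carrier_mat n n"
    by simp
  have det_D: "det (diag_part A) \<noteq> 0"
    using diag by (intro det_upper_triangular_nonzero[OF Dc]) (auto simp: D mat_diag_def)
  show B: "B \<in> carrier_mat n n"
    using mat_inv_carrier[OF Dc det_D] A by simp
  have "mat_diag n (\<lambda>i. A $$ (i, i)) * B = A"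
    using assoc_mult_mat[OF Dc mat_inv_carrier[OF Dc det_D] A] mat_inv_right[OF Dc det_D] A
    by (simp add: D)
  then have "mat n n (\<lambda>(i, j). A $$ (i, i) * B $$ (i, j)) = A"
    by (simp only: mat_diag_mult_left[OF B])
  then have "A $$ (i, i) * B $$ (i, j) = A $$ (i, j)" if "i < n" "j < n" for i j
    using that by (metis (no_types, lifting) case_prod_conv index_mat(1))
  then show "\<And>i j. i < n \<Longrightarrow> j < n \<Longrightarrow> B $$ (i, j) = A $$ (i, j) / A $$ (i, i)"
    using diag by (simp add: field_simps)
qed

text \<open>Dividing row \<open>i\<close> of the eigenvector equation by
  \<open>l * A $$ (i, i)\<close> and rescaling by \<open>v\<close> brings it into the form of
  \<open>maximum_principle_eq\<close>, whose equality case prescribes the arguments of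
  \<open>B\<close>.\<close>

lemma exists_ray_class:
  assumes n: "2 \<le> n" and conn: "connected_on n (\<lambda>i j. A $$ (i, j) \<noteq> 0)"
    and v0: "\<And>i. i < n \<Longrightarrow> 0 < v i"
    and v: "\<And>i. i < n \<Longrightarrow> (\<Sum>j\<in>{..<n} - {i}. cmod (A $$ (i, j)) * v j) = cmod (A $$ (i, i)) * v i"
    and l: "l \<in> spectrum H" "1 \<le> cmod l"
  shows "\<exists>\<phi>. B \<in> ray_class \<phi> n"
proof -
  obtain x where x: "x \<in> carrier_vec n" "x \<noteq> 0\<^sub>v n" "H *\<^sub>v x = l \<cdot>\<^sub>v x"
    using l H by (auto simp: spectrum_def eigenvalue_def eigenvector_def)
  note eigen = H_eigen_iff[OF x(1), THEN iffD1, OF x(3), rule_format]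
  obtain m where m: "m < n" "x $ m \<noteq> 0"
    using x(1,2) by (metis carrier_vecD eq_vecI index_zero_vec)
  have l0: "l \<noteq> 0"
    using l by auto
  \<comment> \<open>After the division by \<open>l\<close>, the factor \<open>1 / l\<close> remains
    below the diagonal only. Its modulus is at most 1 by the assumption on \<open>l\<close>.\<close>
  define \<kappa> where "\<kappa> i j = (if j < i then 1 / l else 1)" for i j :: nat
  define p where "p i j = - (A $$ (i, j) / A $$ (i, i)) * \<kappa> i j * complex_of_real (v j / v i)" for i j
  \<comment> \<open>The scaling by \<open>v\<close> makes the off-diagonal sums of \<open>q\<close>
    equal to 1; \<open>y\<close> is the eigenvector in the scaled coordinates.\<close>
  define q where "q i j = cmod (A $$ (i, j)) / cmod (A $$ (i, i)) * (v j / v i)" for i j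
  define y where "y i = x $ i / complex_of_real (v i)" for i
  have \<kappa>_le: "cmod (\<kappa> i j) \<le> 1" for i j
    using l(2) by (auto simp: \<kappa>_def norm_divide divide_le_eq_1)
  have pq: "cmod (p i j) = q i j * cmod (\<kappa> i j)" if "i < n" "j < n" for i j
    using v0[OF that(1)] v0[OF that(2)] by (simp add: p_def q_def norm_mult norm_divide)
  have q0: "0 \<le> q i j" if "i < n" "j < n" for i j
    using v0[OF that(1)] v0[OF that(2)] by (simp add: q_def)
  have conn_q: "connected_on n (\<lambda>i j. q i j \<noteq> 0)"
    unfolding connected_on_def
  proof (intro allI impI)
    fix S assume S: "S \<subseteq> {..<n}" "S \<noteq> {}" "S \<noteq> {..<n}"
    obtain i j where ij: "i \<in> S" "j < n" "j \<notin> S" "A $$ (i, j) \<noteq> 0"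
      using connected_onE[OF conn S] by metis
    moreover have "i < n"
      using ij S by auto
    ultimately have "q i j \<noteq> 0"
      using v0[of i] v0[of j] diag[of i] by (simp add: q_def)
    then show "\<exists>i\<in>S. \<exists>j\<in>{..<n} - S. q i j \<noteq> 0"
      using ij by auto
  qed
  obtain R where R: "0 < R" "\<And>i. i < n \<Longrightarrow> cmod (y i) = R"
    "\<And>i j. i < n \<Longrightarrow> j < n \<Longrightarrow> i \<noteq> j \<Longrightarrow> p i j * y j = complex_of_real (q i j) * y i"
  proof (rule maximum_principle_eq[OF conn_q, where p = p and y = y and m = m])
    show "(\<Sum>j\<in>{..<n} - {i}. q i j) = 1" if i: "i < n" for i
    proof -
      have "(\<Sum>j\<in>{..<n} - {i}. q i j) =
          (\<Sum>j\<in>{..<n} - {i}. cmod (A $$ (i, j)) * v j) / (cmod (A $$ (i, i)) * v i)"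
        unfolding sum_divide_distrib by (simp add: q_def)
      then show ?thesis
        unfolding v[OF i] using v0[OF i] diag[OF i] by simp
    qed
    show "cmod (p i j) \<le> q i j" if "i < n" "j < n" for i j
      unfolding pq[OF that] using mult_left_mono[OF \<kappa>_le q0[OF that]] by simp
    show "m < n"
      by (rule m)
    show "y m \<noteq> 0"
      using m v0[OF m(1)] by (simp add: y_def)
    show "y i = (\<Sum>j\<in>{..<n} - {i}. p i j * y j)" if i: "i < n" for i
    proof -
      have "p i j * y j = - (A $$ (i, j) * (if j < i then 1 else l) * x $ j) /
          (l * A $$ (i, i) * complex_of_real (v i))" if "j < n" for j
        using v0[OF that] l0 by (auto simp: p_def y_def \<kappa>_def)
      then have "(\<Sum>j\<in>{..<n} - {i}. p i j * y j) =
          (\<Sum>j\<in>{..<n} - {i}. - (A $$ (i, j) * (if j < i then 1 else l) * x $ j) /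
            (l * A $$ (i, i) * complex_of_real (v i)))"
        by (intro sum.cong) auto
      also have "\<dots> = l * A $$ (i, i) * x $ i / (l * A $$ (i, i) * complex_of_real (v i))"
        unfolding eigen[OF i] by (simp only: sum_divide_distrib[symmetric] sum_negf)
      also have "\<dots> = y i"
        using l0 diag[OF i] by (simp add: y_def)
      finally show ?thesis ..
    qed
  qed (rule that)
  have cmod_l: "cmod l = 1"
  proof -
    \<comment> \<open>In the last row every off-diagonal entry lies below the diagonal. Connectivity
      supplies a nonzero one, and equality of moduli there forces \<open>1 / l\<close> to have
      modulus 1.\<close>
    have "{n - 1} \<subseteq> {..<n}" "{n - 1} \<noteq> {}" "{n - 1} \<noteq> {..<n}"
      using n by (auto simp: set_eq_iff intro!: exI[of _ 0])
    then obtain i j where "i \<in> {n - 1}" "j < n" "j \<notin> {n - 1}" "q i j \<noteq> 0"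
      using connected_onE[OF conn_q] by metis
    then have ij: "i < n" "j < n" "j < i" "q i j \<noteq> 0"
      by auto
    have "cmod (p i j) * R = q i j * R"
      using arg_cong[OF R(3)[OF ij(1,2)], of cmod] R(2) ij q0[OF ij(1,2)] by (simp add: norm_mult)
    then have "cmod (\<kappa> i j) = 1"
      using pq[OF ij(1,2)] R(1) ij(4) by simp
    then show ?thesis
      using ij(3) by (simp add: \<kappa>_def norm_divide)
  qed
  define \<theta> where "\<theta> i = Arg (y i)" for i
  define \<phi> where "\<phi> = Arg l"
  have y_cis: "y i = complex_of_real R * cis (\<theta> i)" if "i < n" for i
    using rcis_cmod_Arg[of "y i"] R(2)[OF that] by (simp add: \<theta>_def rcis_def)
  have l_cis: "l = cis \<phi>"
    using rcis_cmod_Arg[of l] cmod_l by (simp add: \<phi>_def rcis_def)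
  have "B \<in> ray_class \<phi> n"
  proof (rule ray_classI[OF B])
    show "B $$ (i, i) = 1" if "i < n" for i
      using diag that by (simp add: B_index)
    fix i j assume ij: "i < n" "j < n" "i \<noteq> j"
    have vv: "v i \<noteq> 0" "v j \<noteq> 0"
      using v0[OF ij(1)] v0[OF ij(2)] by auto
    \<comment> \<open>Both sides of the equality case contain \<open>v j / v i\<close> and, through
      \<open>y\<close>, the common modulus \<open>R\<close>. Cancelling these leaves a relation
      between arguments that can be solved for \<open>B $$ (i, j)\<close>.\<close>
    have "p i j * y j = - B $$ (i, j) * \<kappa> i j * y j * complex_of_real (v j / v i)"
      using ij by (simp add: p_def B_index)
    moreover have "complex_of_real (q i j) * y i = complex_of_real (cmod (B $$ (i, j))) * y i * complex_of_real (v j / v i)"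
      using ij by (simp add: q_def B_index norm_divide)
    ultimately have "- B $$ (i, j) * \<kappa> i j * y j * complex_of_real (v j / v i) =
        complex_of_real (cmod (B $$ (i, j))) * y i * complex_of_real (v j / v i)"
      using R(3)[OF ij] by argo
    then have "- B $$ (i, j) * \<kappa> i j * y j = complex_of_real (cmod (B $$ (i, j))) * y i"
      by (rule mult_right_cancel[THEN iffD1, rotated]) (use vv in simp)
    then have "- B $$ (i, j) * \<kappa> i j * cis (\<theta> j) * complex_of_real R =
        complex_of_real (cmod (B $$ (i, j))) * cis (\<theta> i) * complex_of_real R"
      unfolding y_cis[OF ij(1)] y_cis[OF ij(2)] by (simp only: mult_ac)
    then have eq: "- B $$ (i, j) * \<kappa> i j * cis (\<theta> j) = complex_of_real (cmod (B $$ (i, j))) * cis (\<theta> i)"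
      by (rule mult_right_cancel[THEN iffD1, rotated]) (use R(1) in simp)
    have \<kappa>: "\<kappa> i j = cis (- (if j < i then \<phi> else 0))"
      by (simp add: \<kappa>_def l_cis cis_inverse divide_inverse)
    have "B $$ (i, j) = - (- B $$ (i, j) * \<kappa> i j * cis (\<theta> j)) * cis ((if j < i then \<phi> else 0) - \<theta> j)"
      unfolding \<kappa> by (simp add: mult.assoc cis_mult)
    also have "\<dots> = - complex_of_real (cmod (B $$ (i, j))) * cis (\<theta> i - \<theta> j + (if j < i then \<phi> else 0))"
      unfolding eq by (simp add: cis_mult algebra_simps)
    finally show "B $$ (i, j) = - complex_of_real (cmod (B $$ (i, j))) * cis (\<theta> i - \<theta> j + (if j < i then \<phi> else 0))" .
  qed
  then show ?thesis ..
qed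

text \<open>The eigenvector has the moduli \<open>v\<close> and the arguments
  \<open>\<theta>\<close> of the pattern. All off-diagonal terms of a row are then aligned, so their
  sum is governed by the row equation for \<open>v\<close>.\<close>

lemma ray_class_cis_in_spectrum:
  assumes v0: "\<And>i. i < n \<Longrightarrow> 0 < v i"
    and v: "\<And>i. i < n \<Longrightarrow> (\<Sum>j\<in>{..<n} - {i}. cmod (A $$ (i, j)) * v j) = cmod (A $$ (i, i)) * v i"
    and B_ray: "B \<in> ray_class \<phi> n"
  shows "cis \<phi> \<in> spectrum H"
proof -
  have "B $$ (i, i) = 1" if "i < n" for i
    using diag that by (simp add: B_index)
  then obtain \<theta> where \<theta>: "\<And>i j. i < n \<Longrightarrow> j < n \<Longrightarrow> i \<noteq> j \<Longrightarrow> B $$ (i, j) =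
      - complex_of_real (cmod (B $$ (i, j))) * cis (\<theta> i - \<theta> j + (if j < i then \<phi> else 0))"
    using ray_classE[OF B_ray n_pos] by metis
  define x where "x = vec n (\<lambda>i. complex_of_real (v i) * cis (\<theta> i))"
  have x: "x \<in> carrier_vec n"
    by (simp add: x_def)
  have "x $ 0 \<noteq> 0"
    using v0[OF n_pos] n_pos by (simp add: x_def)
  then have x0: "x \<noteq> 0\<^sub>v n"
    using n_pos by auto
  have "H *\<^sub>v x = cis \<phi> \<cdot>\<^sub>v x"
    unfolding H_eigen_iff[OF x]
  proof (intro allI impI)
    fix i assume i: "i < n"
    \<comment> \<open>The complex factor on the right has modulus 1 and does not depend on
      \<open>j\<close>, so it can be pulled out of the sum. The \<open>\<phi>\<close> in entries
      below the diagonal matches the factor \<open>cis \<phi>\<close> that accompanies those above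
      it.\<close>
    have term_eq: "A $$ (i, j) * (if j < i then 1 else cis \<phi>) * x $ j =
        - (cis \<phi> * cis (\<theta> i) * (A $$ (i, i) / complex_of_real (cmod (A $$ (i, i))))) * complex_of_real (cmod (A $$ (i, j)) * v j)"
      if j: "j < n" "i \<noteq> j" for j
    proof -
      have "A $$ (i, j) = A $$ (i, i) * B $$ (i, j)"
        using diag[OF i] B_index[OF i j(1)] by simp
      also have "\<dots> = - A $$ (i, i) * complex_of_real (cmod (B $$ (i, j))) * cis (\<theta> i - \<theta> j + (if j < i then \<phi> else 0))"
        by (subst \<theta>[OF i j]) simp
      also have "complex_of_real (cmod (B $$ (i, j))) = complex_of_real (cmod (A $$ (i, j))) / complex_of_real (cmod (A $$ (i, i)))"
        using B_index[OF i j(1)] by (simp add: norm_divide)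
      finally have Aij: "A $$ (i, j) = - A $$ (i, i) * (complex_of_real (cmod (A $$ (i, j))) / complex_of_real (cmod (A $$ (i, i))))
          * cis (\<theta> i - \<theta> j + (if j < i then \<phi> else 0))" .
      have rearrange: "c * u * k * (w * t) = c * w * (u * k * t)" for c u k w t :: complex
        by (simp add: mult_ac)
      have xj: "x $ j = complex_of_real (v j) * cis (\<theta> j)"
        using j(1) by (simp add: x_def)
      have cis_eq: "cis (\<theta> i - \<theta> j + (if j < i then \<phi> else 0)) * (if j < i then 1 else cis \<phi>) * cis (\<theta> j) = cis \<phi> * cis (\<theta> i)"
        by (simp add: cis_mult algebra_simps)
      have "- A $$ (i, i) * (complex_of_real (cmod (A $$ (i, j))) / complex_of_real (cmod (A $$ (i, i))))
          * cis (\<theta> i - \<theta> j + (if j < i then \<phi> else 0)) * (if j < i then 1 else cis \<phi>) * x $ j =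
          - A $$ (i, i) * (complex_of_real (cmod (A $$ (i, j))) / complex_of_real (cmod (A $$ (i, i))))
          * complex_of_real (v j) * (cis \<phi> * cis (\<theta> i))"
        unfolding xj by (rule trans[OF rearrange]) (simp only: cis_eq)
      then show ?thesis
        unfolding Aij[symmetric] by (simp add: mult_ac)
    qed
    let ?c = "cis \<phi> * cis (\<theta> i) * (A $$ (i, i) / complex_of_real (cmod (A $$ (i, i))))"
    have "(\<Sum>j\<in>{..<n} - {i}. A $$ (i, j) * (if j < i then 1 else cis \<phi>) * x $ j) =
        (\<Sum>j\<in>{..<n} - {i}. - ?c * complex_of_real (cmod (A $$ (i, j)) * v j))"
      by (intro sum.cong refl term_eq) auto
    also have "\<dots> = - ?c * complex_of_real (cmod (A $$ (i, i)) * v i)"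
      unfolding sum_distrib_left[symmetric] of_real_sum[symmetric] v[OF i] ..
    also have "\<dots> = - (cis \<phi> * A $$ (i, i) * x $ i)"
      using diag[OF i] i by (simp add: x_def)
    finally show "cis \<phi> * A $$ (i, i) * x $ i =
        - (\<Sum>j\<in>{..<n} - {i}. A $$ (i, j) * (if j < i then 1 else cis \<phi>) * x $ j)"
      by simp
  qed
  then show ?thesis
    using x x0 H by (auto simp: spectrum_def eigenvalue_def eigenvector_def)
qed

end

section \<open>A positive null vector of the comparison matrix, and the equivalences\<close>

text \<open>Since \<open>s\<close> is the spectral radius of \<open>C\<close>, the Perron vector of
  \<open>C\<close> is annihilated by \<open>s I - C\<close>, the comparison matrix. Off the diagonal
  \<open>C\<close> has the moduli of \<open>A\<close>, so it inherits connectivity.\<close>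

lemma singular_comparison_mat_perron_vector:
  assumes A: "A \<in> carrier_mat n n" and n: "0 < n"
    and singular: "singular_M_matrix n (comparison_mat A)"
    and conn: "connected_on n (\<lambda>i j. A $$ (i, j) \<noteq> 0)"
  obtains v where "\<And>i. i < n \<Longrightarrow> 0 < v i"
    "\<And>i. i < n \<Longrightarrow> (\<Sum>j\<in>{..<n} - {i}. cmod (A $$ (i, j)) * v j) = cmod (A $$ (i, i)) * v i"
proof -
  obtain s C where C: "C \<in> carrier_mat n n" "0\<^sub>m n n \<le> C" "comparison_mat A = s \<cdot>\<^sub>m 1\<^sub>m n - C"
    and s: "s = spectral_radius (map_mat complex_of_real C)"
    using singular unfolding singular_M_matrix_def by auto
  have C0: "0 \<le> C $$ (i, j)" if "i < n" "j < n" for i j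
    using C(1,2) that by (auto simp: less_eq_mat_def)
  have C_eq: "C $$ (i, j) = (if i = j then s - cmod (A $$ (i, i)) else cmod (A $$ (i, j)))"
    if "i < n" "j < n" for i j
    using arg_cong[OF C(3), of "\<lambda>X. X $$ (i, j)"] A C(1) that
    by (auto simp: comparison_mat_def split: if_splits)
  have "connected_on n (\<lambda>i j. C $$ (i, j) \<noteq> 0)"
    unfolding connected_on_def
  proof (intro allI impI)
    fix S assume S: "S \<subseteq> {..<n}" "S \<noteq> {}" "S \<noteq> {..<n}"
    obtain i j where ij: "i \<in> S" "j < n" "j \<notin> S" "A $$ (i, j) \<noteq> 0"
      using connected_onE[OF conn S] by metis
    moreover have "i < n" "i \<noteq> j"
      using ij(1,3) S(1) by auto
    ultimately have "C $$ (i, j) \<noteq> 0"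
      using C_eq[of i j] by simp
    then show "\<exists>i\<in>S. \<exists>j\<in>{..<n} - S. C $$ (i, j) \<noteq> 0"
      using ij by auto
  qed
  then obtain v where v0: "\<And>i. i < n \<Longrightarrow> 0 < v i"
    and v: "\<And>i. i < n \<Longrightarrow> (\<Sum>j<n. C $$ (i, j) * v j) = s * v i"
    using perron_vector[OF C(1) n C0 _ s] by metis
  have "(\<Sum>j\<in>{..<n} - {i}. cmod (A $$ (i, j)) * v j) = cmod (A $$ (i, i)) * v i" if i: "i < n" for i
  proof -
    have "s * v i = C $$ (i, i) * v i + (\<Sum>j\<in>{..<n} - {i}. C $$ (i, j) * v j)"
      using v[OF i] i by (simp add: sum.remove[of "{..<n}" i])
    also have "(\<Sum>j\<in>{..<n} - {i}. C $$ (i, j) * v j) = (\<Sum>j\<in>{..<n} - {i}. cmod (A $$ (i, j)) * v j)"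
      using i by (intro sum.cong) (auto simp: C_eq)
    finally show ?thesis
      using C_eq[OF i i] by (simp add: algebra_simps)
  qed
  with v0 show ?thesis
    by (rule that)
qed

theorem theorem4p14:
  fixes n :: nat and A :: "complex mat" and b :: "complex vec"
  assumes "n \<ge> 3"
    and "A \<in> mixed_H_matrices n"
    and "irreducible_mat A"
    and "b \<in> carrier_vec n"
  shows "(spectral_radius (BGS_mat A) < 1 \<longleftrightarrow> BGS_converges n A b) \<and>
    (spectral_radius (BGS_mat A) < 1 \<longleftrightarrow>
      (\<forall>\<phi>::real. mat_inv (diag_part A) * A \<notin> ray_class \<phi> n))"
proof -
  have n: "0 < n" "2 \<le> n"
    using assms(1) by auto
  have A: "A \<in> carrier_mat n n" and singular: "singular_M_matrix n (comparison_mat A)"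
    and diag: "\<And>i. i < n \<Longrightarrow> A $$ (i, i) \<noteq> 0"
    using assms(2) by (auto simp: mixed_H_matrices_def)
  interpret nonzero_diagonal n A
    by unfold_locales (fact A n diag)+
  note conn = irreducible_mat_connected_on[OF A assms(3)]
  obtain v where v: "\<And>i. i < n \<Longrightarrow> 0 < v i"
    "\<And>i. i < n \<Longrightarrow> (\<Sum>j\<in>{..<n} - {i}. cmod (A $$ (i, j)) * v j) = cmod (A $$ (i, i)) * v i"
    using singular_comparison_mat_perron_vector[OF A n(1) singular conn] by metis
  have "spectral_radius (BGS_mat A) < 1 \<longleftrightarrow> (\<forall>\<phi>::real. mat_inv (diag_part A) * A \<notin> ray_class \<phi> n)"
  proof
    assume sr: "spectral_radius (BGS_mat A) < 1"
    show "\<forall>\<phi>::real. mat_inv (diag_part A) * A \<notin> ray_class \<phi> n"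
    proof (intro allI notI)
      fix \<phi> assume "mat_inv (diag_part A) * A \<in> ray_class \<phi> n"
      \<comment> \<open>The pattern makes \<open>cis \<phi>\<close>, of modulus 1, an eigenvalue of
        the iteration matrix.\<close>
      then have "cmod (cis \<phi>) \<le> spectral_radius (BGS_mat A)"
        by (intro spectral_radius_mem_max(2)[OF H n(1)] imageI ray_class_cis_in_spectrum[OF v])
      then show False
        using sr by simp
    qed
  next
    assume no: "\<forall>\<phi>::real. mat_inv (diag_part A) * A \<notin> ray_class \<phi> n"
    obtain l where l: "l \<in> spectrum (BGS_mat A)" "spectral_radius (BGS_mat A) = cmod l"
      using spectral_radius_mem_max(1)[OF H n(1)] by auto
    show "spectral_radius (BGS_mat A) < 1"
    proof (rule ccontr)
      assume "\<not> spectral_radius (BGS_mat A) < 1"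
      then show False
        using exists_ray_class[OF n(2) conn v l(1)] l(2) no by auto
    qed
  qed
  then show ?thesis
    using spectral_radius_less_1_iff_converges[OF assms(4)] by simp
qed

end
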